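(* Let $\Omega=\Omega_1\times\cdots\times\Omega_n$ where each $\Omega_i$ is a closed subinterval of the real line, and let $f$ be a smooth convex function from an open neighborhood of $\Omega$ to $\mathbb{R}$ whose set $S$ of minimizers over $\Omega$ is nonempty. Let $x_0\in\Omega$, $R_0:=\|x_0-\mathcal{P}_S(x_0)\|$, and let $(x_j)_{j\ge0}$ be generated by the asynchronous stochastic coordinate descent iteration (defined in the context, separable constrained case) with steplength parameter $\gamma$ and delay bound $\tau$. Suppose that $\tau \ge 1$ and $n\ge 5$ and that $$\tau(\tau + 1) \le \frac{\sqrt{n}\, L_{\max}}{4eL_{\mathrm{res}}}.$$ If we choose $$\rho=1+\frac{4e\tau L_{\mathrm{res}}}{\sqrt{n}\,L_{\max}},$$ and define $$\psi:= 1+\frac{L_{\mathrm{res}}\tau\rho^{\tau}}{\sqrt{n}\,L_{\max}}\left(2 +\frac{L_{\max}}{\sqrt{n}\,L_{\mathrm{res}}} + \frac{2\tau}{n}\right),$$ then the steplength $\gamma=1/2$ satisfies the bounds $$\gamma \le \frac{1}{\psi},\qquad \gamma \le \left(1-\frac{1}{\rho}-\frac{2}{\sqrt{n}}\right)\frac{\sqrt{n}\,L_{\max}}{4L_{\mathrm{res}}\tau\rho^{\tau}}.$$ In addition, with $\gamma=1/2$, if the essential strong convexity property (defined in the context) holds with parameter $l>0$, then for $j=1,2,\dots$ $$\mathbb{E} (f(x_j)-f^* ) \le \left( 1-\frac{l}{n(l+2L_{\max})} \right)^j (L_{\max} R_0^2 + f(x_0)-f^* ),$$ while for the case of general smooth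 convex $f$, $$\mathbb{E} (f(x_j)-f^* ) \le \frac{n(L_{\max} R_0^2 + f(x_0)-f^* )}{j+n}.$$
   Context: Notation: $\|\cdot\|$ is the Euclidean norm, $e_i$ the $i$th standard basis vector, $\nabla_i f(x)$ the $i$th component of $\nabla f(x)$; in the constants, $e$ is the base of the natural logarithm. $S\subset\Omega$ is the set on which $f$ attains its minimum over $\Omega$ (assumed nonempty), $f^*$ the optimal value; $\mathcal{P}_S$ and $\mathcal{P}_\Omega$ are Euclidean projections onto $S$ and $\Omega$. Lipschitz constants: $L_{\mathrm{res}}$ is the restricted Lipschitz constant of $\nabla f$: $\|\nabla f(x)-\nabla f(x+te_i)\|\le L_{\mathrm{res}}|t|$ for all $i=1,\dots,n$ and $t\in\mathbb{R}$ with $x,x+te_i\in\Omega$. $L_i$ is the coordinate Lipschitz constant of $\nabla f$ in the $i$th coordinate direction: $f(x+te_i)-f(x)\le \nabla_i f(x)\,t+\frac{L_i}{2}t^2$ whenever $x,x+te_i\in\Omega$, or equivalently $|\nabla_i f(x)-\nabla_i f(x+te_i)|\le L_i|t|$. $L_{\max}:=\max_{i=1,\dots,n} L_i$. One has $L_{\mathrm{res}}\ge L_{\max}$. Essential strong convexity with parameter $l>0$: $f(x)-f(y)\ge\langle\nabla f(y),x-y\rangle+\frac{l}{2}\|x-y\|^2$ for all $x,y\in\Omega$ with $\mathcal{P}_S(x)=\mathcal{P}_S(y)$. Iteration (separable constrained case): several processors update a shared vector $x$ without synchronization; $x_j$ is the state of $x$ after $j$ updates. Starting from $x_0\in\Omega$,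 at each step $j=0,1,2,\dots$ an index $i(j)$ is chosen at random from $\{1,\dots,n\}$ with equal probability, and $$x_{j+1}=\mathcal{P}_\Omega\left(x_j-\frac{\gamma}{L_{\max}}\,e_{i(j)}\nabla_{i(j)}f(x_{k(j)})\right),$$ where $k(j)$ is the index of the iterate at which the update applied at step $j$ was calculated. It satisfies $k(j)\le j$, and the delay is assumed to be bounded uniformly by a positive integer $\tau$: $j-k(j)\le\tau$ for all $j$. The indices $i(j)$ are random variables, and $\mathbb{E}$ denotes expectation over all random variables. *)

theory Defs
  imports "HOL-Probability.Probability"
begin

definition coord_box :: "('n::finite \<Rightarrow> real set) \<Rightarrow> (real ^ 'n) set"
  where "coord_box J = {x. \<forall>c. x $ c \<in> J c}"

definition grad :: "('a::real_inner \<Rightarrow> real) \<Rightarrow> 'a \<Rightarrow> 'a"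
  where "grad f x = (THE D. GDERIV f x :> D)"

definition minimizers :: "('a \<Rightarrow> real) \<Rightarrow> 'a set \<Rightarrow> 'a set"
  where "minimizers f \<Omega> = {x \<in> \<Omega>. \<forall>y \<in> \<Omega>. f x \<le> f y}"

definition opt_value :: "('a \<Rightarrow> real) \<Rightarrow> 'a set \<Rightarrow> real"
  where "opt_value f \<Omega> = (INF x \<in> \<Omega>. f x)"

(* The two predicates below hold for every admissible constant, not only for the smallest one. *)

definition restricted_lipschitz :: "(real ^ 'n \<Rightarrow> real) \<Rightarrow> (real ^ 'n::finite) set \<Rightarrow> real \<Rightarrow> bool"
  where "restricted_lipschitz f \<Omega> L \<longleftrightarrow> 0 \<le> L \<and>
    (\<forall>c x t. x \<in> \<Omega> \<longrightarrow> x + t *\<^sub>R axis c 1 \<in> \<Omega> \<longrightarrow>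
       norm (grad f x - grad f (x + t *\<^sub>R axis c 1)) \<le> L * \<bar>t\<bar>)"

definition coord_lipschitz :: "(real ^ 'n \<Rightarrow> real) \<Rightarrow> (real ^ 'n::finite) set \<Rightarrow> 'n \<Rightarrow> real \<Rightarrow> bool"
  where "coord_lipschitz f \<Omega> c L \<longleftrightarrow> 0 \<le> L \<and>
    (\<forall>x t. x \<in> \<Omega> \<longrightarrow> x + t *\<^sub>R axis c 1 \<in> \<Omega> \<longrightarrow>
       f (x + t *\<^sub>R axis c 1) - f x \<le> (grad f x $ c) * t + L / 2 * t\<^sup>2)"

(* closest_point is the Euclidean projection whenever its set argument is nonempty, closed and
   convex, as the set of minimizers is for a continuous convex f on a nonempty closed convex set. *)

definition essentially_strongly_convex ::
    "('a::euclidean_space \<Rightarrow> real) \<Rightarrow> 'a set \<Rightarrow> real \<Rightarrow> bool"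
  where "essentially_strongly_convex f \<Omega> l \<longleftrightarrow>
    (\<forall>x \<in> \<Omega>. \<forall>y \<in> \<Omega>.
       closest_point (minimizers f \<Omega>) x = closest_point (minimizers f \<Omega>) y \<longrightarrow>
       f x - f y \<ge> grad f y \<bullet> (x - y) + l / 2 * (norm (x - y))\<^sup>2)"

(* The chosen coordinates are independent and uniform; the independence includes measurability. *)

definition uniform_coordinate_choices :: "'w measure \<Rightarrow> (nat \<Rightarrow> 'w \<Rightarrow> 'n::finite) \<Rightarrow> bool"
  where "uniform_coordinate_choices M I \<longleftrightarrow>
    prob_space.indep_vars M (\<lambda>_. count_space UNIV) I UNIV \<and>
    (\<forall>j c. measure M {\<omega> \<in> space M. I j \<omega> = c} = 1 / real CARD('n))"

(* The delay sequence k is an arbitrary but deterministic sequence; the only randomness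
   is in the chosen coordinates. *)

definition bounded_delay :: "nat \<Rightarrow> (nat \<Rightarrow> nat) \<Rightarrow> bool"
  where "bounded_delay \<tau> k \<longleftrightarrow> (\<forall>j. k j \<le> j \<and> j - k j \<le> \<tau>)"

definition async_coordinate_descent ::
    "(real ^ 'n \<Rightarrow> real) \<Rightarrow> (real ^ 'n::finite) set \<Rightarrow> real \<Rightarrow> real \<Rightarrow> real ^ 'n \<Rightarrow>
     (nat \<Rightarrow> nat) \<Rightarrow> 'w measure \<Rightarrow> (nat \<Rightarrow> 'w \<Rightarrow> 'n) \<Rightarrow> (nat \<Rightarrow> 'w \<Rightarrow> real ^ 'n) \<Rightarrow> bool"
  where "async_coordinate_descent f \<Omega> Lmax \<gamma> x0 k M I x \<longleftrightarrow>
    (\<forall>\<omega> \<in> space M. x 0 \<omega> = x0 \<and>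
       (\<forall>j. x (Suc j) \<omega> =
          closest_point \<Omega>
            (x j \<omega> - (\<gamma> / Lmax * grad f (x (k j) \<omega>) $ I j \<omega>) *\<^sub>R axis (I j \<omega>) 1)))"

end

theory Submission
  imports Defs
begin

text \<open>
  Let \<open>a\<^sub>j\<close> be the step that updates all coordinates at once, so that the actual step is one
  uniformly chosen component of it and has mean square \<open>E \<parallel>a\<^sub>j\<parallel>\<^sup>2 / n\<close>. Between two
  consecutive times, \<open>a\<^sub>j\<close> changes only by a few such small steps, hence \<open>E \<parallel>a\<^sub>j\<parallel>\<^sup>2\<close>
  shrinks by at most the factor \<open>\<rho>\<close>, and over a whole delay window by at most \<open>\<rho> ^ \<tau> \<le> e\<close>.
  This bounds all errors caused by stale gradients by a small multiple of \<open>E \<parallel>a\<^sub>j\<parallel>\<^sup>2 / n\<close>,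
  which the quadratic decrease of a projected coordinate step absorbs. Consequently \<open>E f(x\<^sub>j)\<close> is
  decreasing, and \<open>L\<^sub>m\<^sub>a\<^sub>x E dist(x\<^sub>j, S)\<^sup>2 + E (f(x\<^sub>j) - f\<^sup>*)\<close> decreases by at least
  \<open>E (f(x\<^sub>j) - f\<^sup>*) / n\<close> in each step; both rates follow.
\<close>

section \<open>Gradients of convex functions\<close>

text \<open>The Riesz representative of the derivative is \<open>adjoint f' 1\<close>; uniqueness of
  derivatives makes the \<open>THE\<close> in \<open>grad\<close> denote it.\<close>

lemma GDERIV_grad:
  fixes f :: "'a::euclidean_space \<Rightarrow> real"
  assumes "f differentiable (at x)"
  shows "GDERIV f x :> grad f x"
proof -
  obtain f' where f': "(f has_derivative f') (at x)"
    using assms by (auto simp: differentiable_def)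
  then have "linear f'"
    by (rule has_derivative_linear)
  then have "f' = (\<lambda>h. h \<bullet> adjoint f' 1)"
    by (auto simp: adjoint_works)
  with f' have D: "GDERIV f x :> adjoint f' 1"
    by (simp add: gderiv_def)
  moreover have "D' = adjoint f' 1" if "GDERIV f x :> D'" for D'
    using has_derivative_unique that D unfolding gderiv_def
    by (metis (mono_tags, lifting) vector_eq_ldot)
  ultimately show ?thesis
    unfolding grad_def by (metis theI)
qed

text \<open>The limit is one-sided because both uses compare values of \<open>f\<close> only along
  segments that start at \<open>x\<close> and stay in \<open>\<Omega>\<close>.\<close>

lemma grad_directional_limit:
  fixes f :: "'a::euclidean_space \<Rightarrow> real"
  assumes "f differentiable (at x)"
  shows "((\<lambda>t. (f (x + t *\<^sub>R v) - f x) / t) \<longlongrightarrow> grad f x \<bullet> v) (at_right 0)"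
proof -
  have "(f has_derivative (\<lambda>h. h \<bullet> grad f x)) (at (x + 0 *\<^sub>R v))"
    using GDERIV_grad[OF assms] by (simp add: gderiv_def)
  moreover have "((\<lambda>t. x + t *\<^sub>R v) has_derivative (\<lambda>t. t *\<^sub>R v)) (at 0)"
    by (auto intro!: derivative_eq_intros)
  ultimately have "((\<lambda>t. f (x + t *\<^sub>R v)) has_derivative (\<lambda>t. (t *\<^sub>R v) \<bullet> grad f x)) (at 0)"
    using has_derivative_compose by fastforce
  then have "((\<lambda>t. f (x + t *\<^sub>R v)) has_real_derivative grad f x \<bullet> v) (at 0)"
    by (simp add: has_field_derivative_def mult_commute_abs inner_commute)
  then have "((\<lambda>t. (f (x + t *\<^sub>R v) - f x) / t) \<longlongrightarrow> grad f x \<bullet> v) (at 0)"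
    by (simp add: DERIV_def)
  then show ?thesis
    by (rule filterlim_mono) (auto simp: at_within_le_at)
qed

text \<open>Convexity bounds each difference quotient along the segment by its value at
  \<open>t = 1\<close>, and the limit at 0 keeps the bound.\<close>

lemma convex_on_grad_le:
  fixes f :: "'a::euclidean_space \<Rightarrow> real"
  assumes f: "convex_on \<Omega> f" and x: "x \<in> \<Omega>" and y: "y \<in> \<Omega>" and d: "f differentiable (at x)"
  shows "grad f x \<bullet> (y - x) \<le> f y - f x"
proof (rule tendsto_upperbound[OF grad_directional_limit[OF d]])
  show "\<forall>\<^sub>F t in at_right 0. (f (x + t *\<^sub>R (y - x)) - f x) / t \<le> f y - f x"
  proof (rule eventually_at_rightI[of 0 1])
    fix t :: real assume t: "t \<in> {0<..<1}"
    then have "f ((1 - t) *\<^sub>R x + t *\<^sub>R y) \<le> (1 - t) * f x + t * f y"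
      using f x y by (auto simp: convex_on_def)
    moreover have "(1 - t) *\<^sub>R x + t *\<^sub>R y = x + t *\<^sub>R (y - x)"
      by (simp add: algebra_simps)
    ultimately show "(f (x + t *\<^sub>R (y - x)) - f x) / t \<le> f y - f x"
      using t by (simp add: field_simps)
  qed simp
qed simp

text \<open>First-order optimality: the segment stays in \<open>\<Omega>\<close>, so all difference
  quotients at the minimizer are nonnegative.\<close>

lemma minimizer_grad_nonneg:
  fixes f :: "'a::euclidean_space \<Rightarrow> real"
  assumes "convex \<Omega>" and x: "x \<in> minimizers f \<Omega>" and y: "y \<in> \<Omega>" and d: "f differentiable (at x)"
  shows "0 \<le> grad f x \<bullet> (y - x)"
proof (rule tendsto_lowerbound[OF grad_directional_limit[OF d]])
  show "\<forall>\<^sub>F t in at_right 0. 0 \<le> (f (x + t *\<^sub>R (y - x)) - f x) / t"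
  proof (rule eventually_at_rightI[of 0 1])
    fix t :: real assume t: "t \<in> {0<..<1}"
    have "(1 - t) *\<^sub>R x + t *\<^sub>R y \<in> \<Omega>"
      using \<open>convex \<Omega>\<close> x y t by (intro convexD) (auto simp: minimizers_def)
    moreover have "(1 - t) *\<^sub>R x + t *\<^sub>R y = x + t *\<^sub>R (y - x)"
      by (simp add: algebra_simps)
    ultimately show "0 \<le> (f (x + t *\<^sub>R (y - x)) - f x) / t"
      using t x by (auto simp: minimizers_def)
  qed simp
qed simp

text \<open>A nonempty set of minimizers is a sublevel set of a continuous function; its closedness
  makes projecting onto it meaningful.\<close>

lemma closed_minimizers:
  fixes f :: "'a::metric_space \<Rightarrow> real"
  assumes "closed \<Omega>" "continuous_on \<Omega> f"
  shows "closed (minimizers f \<Omega>)"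
proof (cases "minimizers f \<Omega> = {}")
  case False
  then obtain s where s: "s \<in> minimizers f \<Omega>"
    by auto
  then have "minimizers f \<Omega> = \<Omega> \<inter> f -` {..f s}"
    by (force simp: minimizers_def)
  then show ?thesis
    using continuous_closed_preimage[OF assms(2,1)] by simp
qed auto

lemma opt_value_eq:
  assumes "s \<in> minimizers f \<Omega>"
  shows "opt_value f \<Omega> = f s"
  using assms unfolding opt_value_def minimizers_def by (auto intro!: cInf_eq_minimum)

section \<open>Projections\<close>

text \<open>Firm nonexpansiveness. The obtuse-angle inequalities at \<open>p\<close> and
  \<open>q\<close> show that residual difference and projection difference have nonnegative inner
  product; expanding the square of \<open>norm (a - b)\<close> then leaves two nonnegative terms to
  drop.\<close>

lemma closest_point_residual_nonexpansive:
  fixes a b :: "'a::euclidean_space"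
  assumes S: "convex S" "closed S" "S \<noteq> {}"
  shows "norm ((a - closest_point S a) - (b - closest_point S b)) \<le> norm (a - b)"
proof -
  define p q where "p = closest_point S a" and "q = closest_point S b"
  have "p \<in> S" "q \<in> S"
    using S by (auto simp: p_def q_def closest_point_in_set)
  then have "(a - p) \<bullet> (q - p) \<le> 0" "(b - q) \<bullet> (p - q) \<le> 0"
    using S by (auto simp: p_def q_def intro: closest_point_dot)
  then have "0 \<le> ((a - p) - (b - q)) \<bullet> (p - q)"
    by (simp add: inner_diff_left inner_diff_right)
  moreover have "(norm (a - b))\<^sup>2 = (norm ((a - p) - (b - q)))\<^sup>2
      + 2 * (((a - p) - (b - q)) \<bullet> (p - q)) + (norm (p - q))\<^sup>2"
    by (simp add: power2_norm_eq_inner inner_diff_left inner_diff_right inner_commute)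
  ultimately have "(norm ((a - p) - (b - q)))\<^sup>2 \<le> (norm (a - b))\<^sup>2"
    using zero_le_power2[of "norm (p - q)"] by linarith
  then show ?thesis
    by (simp add: p_def q_def)
qed

lemma closed_coord_box: "(\<And>c. closed (J c)) \<Longrightarrow> closed (coord_box J)"
  unfolding coord_box_def using closed_vimage_vec_nth by (intro closed_Collect_all) (auto simp: vimage_def)

lemma convex_coord_box:
  assumes "\<And>c. convex (J c)"
  shows "convex (coord_box J)"
  using assms unfolding coord_box_def convex_alt by auto

text \<open>The vector of interval projections minimizes every component distance, hence the norm,
  and the projection is unique.\<close>

lemma closest_point_coord_box:
  fixes y :: "real ^ 'n::finite"
  assumes J: "\<And>c. closed (J c)" "\<And>c. convex (J c)" and ne: "coord_box J \<noteq> {}"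
  shows "closest_point (coord_box J) y $ c = closest_point (J c) (y $ c)"
proof -
  define z :: "real ^ 'n" where "z = (\<chi> c. closest_point (J c) (y $ c))"
  have Jne: "J c \<noteq> {}" for c
    using ne by (auto simp: coord_box_def)
  have "z = closest_point (coord_box J) y"
  proof (rule closest_point_unique)
    show "convex (coord_box J)" "closed (coord_box J)"
      using J by (auto intro: convex_coord_box closed_coord_box)
    show "z \<in> coord_box J"
      using J(1) Jne by (auto simp: z_def coord_box_def closest_point_in_set)
    show "\<forall>w \<in> coord_box J. dist y z \<le> dist y w"
    proof
      fix w assume w: "w \<in> coord_box J"
      have "dist (y $ c) (closest_point (J c) (y $ c)) \<le> dist (y $ c) (w $ c)" for c
        using w J(1) by (intro closest_point_le) (auto simp: coord_box_def)
      then show "dist y z \<le> dist y w"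
        unfolding dist_norm by (intro norm_le_componentwise_cart) (simp add: z_def)
    qed
  qed
  then show ?thesis
    by (metis z_def vec_lambda_beta)
qed

section \<open>Averages over finite coordinate sequences\<close>

text \<open>The first \<open>N\<close> iterates depend on \<open>N\<close> coordinate choices only, so that their expectations
  are averages over the finite set of choice sequences. Sequences are functions on \<open>nat\<close> that are
  \<open>undefined\<close> from \<open>N\<close> on.\<close>

definition seq_mean :: "nat \<Rightarrow> ((nat \<Rightarrow> 'n::finite) \<Rightarrow> real) \<Rightarrow> real"
  where "seq_mean N G = (\<Sum>i \<in> {..<N} \<rightarrow>\<^sub>E UNIV. G i) / real CARD('n) ^ N"

lemma card_sequences: "card ({..<N} \<rightarrow>\<^sub>E (UNIV :: 'n::finite set)) = CARD('n) ^ N"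
  by (simp add: card_PiE)

lemma seq_mean_add: "seq_mean N (\<lambda>i. G i + H i) = seq_mean N G + seq_mean N H"
  by (simp add: seq_mean_def sum.distrib add_divide_distrib)

lemma seq_mean_diff: "seq_mean N (\<lambda>i. G i - H i) = seq_mean N G - seq_mean N H"
  by (simp add: seq_mean_def sum_subtractf diff_divide_distrib)

lemma seq_mean_cmult: "seq_mean N (\<lambda>i. c * G i) = c * seq_mean N G"
  by (simp add: seq_mean_def sum_distrib_left)

lemma seq_mean_sum: "seq_mean N (\<lambda>i. \<Sum>a \<in> A. G a i) = (\<Sum>a \<in> A. seq_mean N (G a))"
  unfolding seq_mean_def by (subst sum.swap) (simp add: sum_divide_distrib)

lemma seq_mean_const: "seq_mean N (\<lambda>i :: nat \<Rightarrow> 'n::finite. c) = c"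
  by (simp add: seq_mean_def card_sequences)

lemma seq_mean_mono: "(\<And>i. G i \<le> H i) \<Longrightarrow> seq_mean N G \<le> seq_mean N H"
  by (simp add: seq_mean_def divide_right_mono sum_mono)

lemma seq_mean_nonneg: "(\<And>i. 0 \<le> G i) \<Longrightarrow> 0 \<le> seq_mean N G"
  by (simp add: seq_mean_def sum_nonneg)

text \<open>This is conditioning on all choices but the \<open>j\<close>-th: since
  \<open>H i\<close> does not look at \<open>i j\<close>, its second argument may be redrawn
  uniformly.\<close>

lemma seq_mean_resample:
  fixes H :: "(nat \<Rightarrow> 'n::finite) \<Rightarrow> 'n \<Rightarrow> real"
  assumes "j < N" and H: "\<And>i c c'. H (i(j := c)) c' = H i c'"
  shows "seq_mean N (\<lambda>i. H i (i j)) = seq_mean N (\<lambda>i. \<Sum>c \<in> UNIV. H i c) / real CARD('n)"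
proof -
  let ?P = "{..<N} \<rightarrow>\<^sub>E (UNIV :: 'n set)" and ?swap = "\<lambda>(i, c). (i(j := c), i j)"
  have "(\<Sum>i \<in> ?P. \<Sum>c \<in> UNIV. H i c) = (\<Sum>(i, c) \<in> ?P \<times> UNIV. H i c)"
    by (simp add: sum.cartesian_product)
  also have "\<dots> = (\<Sum>(i, c) \<in> ?P \<times> (UNIV :: 'n set). H i (i j))"
  \<comment> \<open>Exchanging the entry \<open>i j\<close> with the free coordinate
    \<open>c\<close> is an involution, so it serves as its own inverse.\<close>
  proof (rule sum.reindex_bij_witness[where i = ?swap and j = ?swap])
    fix p assume "p \<in> ?P \<times> (UNIV :: 'n set)"
    then show "?swap p \<in> ?P \<times> UNIV" "?swap p \<in> ?P \<times> UNIV"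
      using \<open>j < N\<close> by (cases p; simp add: PiE_iff extensional_def)+
    show "?swap (?swap p) = p" "?swap (?swap p) = p"
      by (cases p; simp)+
    show "(case ?swap p of (i, c) \<Rightarrow> H i (i j)) = (case p of (i, c) \<Rightarrow> H i c)"
      by (cases p; simp add: H)
  qed
  also have "\<dots> = real CARD('n) * (\<Sum>i \<in> ?P. H i (i j))"
    by (simp add: sum.cartesian_product[symmetric] sum_distrib_left)
  finally show ?thesis
    by (simp add: seq_mean_def)
qed

text \<open>The first \<open>N\<close> choices partition the space into events on which
  \<open>G\<close> is constant; by independence and uniformity all of these events are equally
  likely.\<close>

lemma integral_uniform_choices:
  fixes I :: "nat \<Rightarrow> 'w \<Rightarrow> 'n::finite" and G :: "(nat \<Rightarrow> 'n) \<Rightarrow> real"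
  assumes "prob_space M" and choices: "uniform_coordinate_choices M I" and "N \<noteq> 0"
    and G: "\<And>i i'. (\<And>m. m < N \<Longrightarrow> i m = i' m) \<Longrightarrow> G i = G i'"
  shows "(\<integral>\<omega>. G (\<lambda>m. I m \<omega>) \<partial>M) = seq_mean N G"
proof -
  interpret prob_space M by fact
  let ?P = "{..<N} \<rightarrow>\<^sub>E (UNIV :: 'n set)"
  \<comment> \<open>For \<open>N = 0\<close> this intersection would be \<open>UNIV\<close> instead
    of \<open>space M\<close>, hence the assumption \<open>N \<noteq> 0\<close>.\<close>
  define E where "E p = (\<Inter>m \<in> {..<N}. I m -` {p m} \<inter> space M)" for p
  have indep: "indep_vars (\<lambda>_. count_space UNIV) I UNIV"
    and unif: "\<And>j c. prob {\<omega> \<in> space M. I j \<omega> = c} = 1 / real CARD('n)"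
    using choices by (auto simp: uniform_coordinate_choices_def)
  have I: "I m \<in> measurable M (count_space UNIV)" for m
    using indep by (auto simp: indep_vars_def)
  have fin: "finite ?P"
    by (intro finite_PiE) auto
  have E[measurable]: "E p \<in> sets M" for p
    using \<open>N \<noteq> 0\<close> unfolding E_def by (intro sets.finite_INT) (auto intro: measurable_sets[OF I])
  have "prob (E p) = 1 / real CARD('n) ^ N" for p
  proof -
    have "prob (E p) = (\<Prod>m \<in> {..<N}. prob (I m -` {p m} \<inter> space M))"
      using \<open>N \<noteq> 0\<close> unfolding E_def by (intro indep_varsD[OF indep]) auto
    also have "\<dots> = (\<Prod>m \<in> {..<N}. 1 / real CARD('n))"
      using unif by (intro prod.cong) (auto simp: vimage_def Int_def conj_commute)
    finally show ?thesis
      by (simp add: power_one_over)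
  qed
  moreover have "(\<integral>\<omega>. G (\<lambda>m. I m \<omega>) \<partial>M) = (\<integral>\<omega>. (\<Sum>p \<in> ?P. G p * indicator (E p) \<omega>) \<partial>M)"
  proof (rule Bochner_Integration.integral_cong[OF refl])
    fix \<omega> assume w: "\<omega> \<in> space M"
    let ?q = "restrict (\<lambda>m. I m \<omega>) {..<N}"
    have "\<omega> \<in> E p \<longleftrightarrow> p = ?q" if "p \<in> ?P" for p
    proof -
      have "\<omega> \<in> E p \<longleftrightarrow> (\<forall>m < N. I m \<omega> = p m)"
        using w \<open>N \<noteq> 0\<close> by (auto simp: E_def)
      also have "\<dots> \<longleftrightarrow> p = ?q"
        using that by (auto simp: fun_eq_iff PiE_iff extensional_def)
      finally show ?thesis .
    qed
    then have "(\<Sum>p \<in> ?P. G p * indicator (E p) \<omega>) = (\<Sum>p \<in> ?P. if p = ?q then G p else 0)"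
      by (intro sum.cong) (auto simp: indicator_def)
    also have "\<dots> = G ?q"
      using fin by (simp add: sum.delta)
    also have "\<dots> = G (\<lambda>m. I m \<omega>)"
      by (rule G) simp
    finally show "G (\<lambda>m. I m \<omega>) = (\<Sum>p \<in> ?P. G p * indicator (E p) \<omega>)" ..
  qed
  moreover have "\<dots> = (\<Sum>p \<in> ?P. \<integral>\<omega>. G p * indicator (E p) \<omega> \<partial>M)"
    by (intro Bochner_Integration.integral_sum integrable_mult_right integrable_real_indicator E)
       (simp add: emeasure_eq_measure)
  ultimately show ?thesis
    by (simp add: seq_mean_def sum_divide_distrib)
qed

section \<open>The asynchronous iteration with steplength one half\<close>

text \<open>No probability space occurs here: iterates are functions of a choice sequence, and
  expectations are \<open>seq_mean\<close>. A common \<open>Lmax\<close> serves all coordinates, and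
  \<open>tau_le\<close> is the delay condition cleared of denominators.\<close>

locale async_descent =
  fixes J :: "'n::finite \<Rightarrow> real set"
    and \<Omega> :: "(real ^ 'n) set"
    and f :: "real ^ 'n \<Rightarrow> real"
    and n Lres Lmax :: real
    and x0 :: "real ^ 'n"
    and \<tau> :: nat
    and k :: "nat \<Rightarrow> nat"
  assumes n: "n = real CARD('n)"
    and J_closed: "closed (J c)" and J_convex: "convex (J c)"
    and Omega: "\<Omega> = coord_box J"
    and differentiable: "z \<in> \<Omega> \<Longrightarrow> f differentiable (at z)"
    and convex_f: "convex_on \<Omega> f"
    and restricted: "restricted_lipschitz f \<Omega> Lres"
    and coord: "coord_lipschitz f \<Omega> c Lmax"
    and minimizers_ne: "minimizers f \<Omega> \<noteq> {}"
    and x0: "x0 \<in> \<Omega>"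
    and Lmax_pos: "0 < Lmax" and Lmax_le: "Lmax \<le> Lres"
    and tau_pos: "1 \<le> \<tau>"
    and tau_le: "4 * exp 1 * Lres * (real \<tau> * (real \<tau> + 1)) \<le> sqrt n * Lmax"
    and delay: "bounded_delay \<tau> k"
begin

section \<open>Numerical consequences of the delay condition\<close>

abbreviation r :: real where "r \<equiv> sqrt n"

text \<open>A random single-coordinate step has root mean square \<open>1 / r\<close> times that of
  the full step, so \<open>\<epsilon>\<close> measures the gradient change it causes, in units of
  \<open>Lmax\<close>.\<close>

definition \<epsilon> :: real where "\<epsilon> = Lres / (r * Lmax)"

definition \<rho> :: real where "\<rho> = 1 + 4 * exp 1 * real \<tau> * \<epsilon>"

abbreviation \<kappa> :: real where "\<kappa> \<equiv> \<rho> ^ \<tau>"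

lemma n_ge_1: "1 \<le> n"
  by (simp add: n Suc_leI)

lemma r_pos: "0 < r"
  using n_ge_1 by simp

lemma Lres_pos: "0 < Lres"
  using Lmax_pos Lmax_le by simp

lemma eps_pos: "0 < \<epsilon>"
  using Lmax_pos Lmax_le r_pos by (simp add: \<epsilon>_def)

text \<open>Equivalent to \<open>Lmax \<le> Lres\<close>; it lets terms from the displacement of the
  iterates be charged to \<open>\<epsilon>\<close> as well.\<close>

lemma inverse_r_le: "1 / r \<le> \<epsilon>"
  using Lmax_pos Lmax_le r_pos by (simp add: \<epsilon>_def field_simps)

lemma Lres_eq: "Lres / r = Lmax * \<epsilon>"
  using Lmax_pos r_pos by (simp add: \<epsilon>_def)

lemma tau_ge_1: "1 \<le> real \<tau>"
  using tau_pos by simp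

lemma eps_tau_le: "4 * exp 1 * \<epsilon> * (real \<tau> * (real \<tau> + 1)) \<le> 1"
  using tau_le Lmax_pos r_pos by (simp add: \<epsilon>_def field_simps)

lemma exp_1_ge: "5 / 2 \<le> exp (1 :: real)"
  using exp_lower_Taylor_quadratic[of "1 :: real"] by simp

lemma rho_gt_1: "1 < \<rho>"
  using eps_pos tau_ge_1 by (simp add: \<rho>_def)

lemma rho_le: "\<rho> \<le> 1 + 1 / (real \<tau> + 1)"
proof -
  have "4 * exp 1 * \<epsilon> * real \<tau> \<le> 1 / (real \<tau> + 1)"
    using eps_tau_le by (simp add: pos_le_divide_eq mult_ac)
  then show ?thesis
    by (simp add: \<rho>_def mult_ac)
qed

lemma rho_le_three_halves: "\<rho> \<le> 3 / 2"
proof -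
  have "1 / (real \<tau> + 1) \<le> 1 / 2"
    using tau_ge_1 by (intro divide_left_mono) auto
  then show ?thesis
    using rho_le by linarith
qed

text \<open>The product is the power of \<open>\<rho>\<close> with exponent
  \<open>\<tau> + 1\<close>, and \<open>\<rho>\<close> is at most
  \<open>1 + 1 / (\<tau> + 1)\<close>. The extra factor beyond \<open>\<kappa>\<close> is needed
  when estimates are divided by \<open>\<rho>\<close>.\<close>

lemma rho_kappa_le: "\<rho> * \<kappa> \<le> exp 1"
proof -
  have "\<rho> \<le> exp (1 / (real \<tau> + 1))"
    using rho_le exp_ge_add_one_self[of "1 / (real \<tau> + 1)"] by linarith
  then have "\<rho> ^ Suc \<tau> \<le> exp (1 / (real \<tau> + 1)) ^ Suc \<tau>"
    using rho_gt_1 by (intro power_mono) auto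
  also have "\<dots> = exp (real (Suc \<tau>) * (1 / (real \<tau> + 1)))"
    by (rule exp_of_nat_mult[symmetric])
  also have "\<dots> = exp 1"
    by (simp add: field_simps)
  finally show ?thesis
    by simp
qed

lemma kappa_ge_1: "1 \<le> \<kappa>"
  using rho_gt_1 by (simp add: one_le_power)

lemma kappa_le: "\<kappa> \<le> exp 1"
proof -
  have "1 * \<kappa> \<le> \<rho> * \<kappa>"
    using rho_gt_1 kappa_ge_1 by (intro mult_right_mono) auto
  then show ?thesis
    using rho_kappa_le by simp
qed

text \<open>The 8 is the 4 of the delay condition times \<open>\<tau> + 1 \<ge> 2\<close>; its
  factor \<open>exp 1\<close> absorbs \<open>\<kappa>\<close>.\<close>

lemma eps_tau_kappa_le: "\<epsilon> * real \<tau> * \<kappa> \<le> 1 / 8"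
proof -
  have "\<epsilon> * real \<tau> * \<kappa> \<le> \<epsilon> * real \<tau> * exp 1"
    using eps_pos kappa_le by (intro mult_left_mono) auto
  moreover have "4 * exp 1 * \<epsilon> * (real \<tau> * 2) \<le> 4 * exp 1 * \<epsilon> * (real \<tau> * (real \<tau> + 1))"
    using eps_pos tau_ge_1 by (intro mult_left_mono) auto
  ultimately show ?thesis
    using eps_tau_le by (simp add: mult_ac)
qed

lemma eps_tau_le_8: "\<epsilon> * real \<tau> \<le> 1 / 8"
proof -
  have "\<epsilon> * real \<tau> * 1 \<le> \<epsilon> * real \<tau> * \<kappa>"
    using eps_pos kappa_ge_1 by (intro mult_left_mono) auto
  then show ?thesis
    using eps_tau_kappa_le by simp
qed

text \<open>The left side is the relative loss of \<open>A N j\<close> in one step, as found in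
  \<open>A_growth\<close>; the inequality closes that induction. Multiplied by
  \<open>\<rho>\<close>, its right side becomes
  \<open>4 * exp 1 * \<tau> * \<epsilon>\<close>.\<close>

lemma rho_contraction: "\<epsilon> * (4 + real \<tau> + real \<tau> * \<kappa>) \<le> 1 - 1 / \<rho>"
proof -
  have "real \<tau> * (\<rho> * \<kappa>) \<le> real \<tau> * exp 1"
    using rho_kappa_le by (intro mult_left_mono) auto
  moreover have "(4 + real \<tau>) * \<rho> \<le> (4 + real \<tau>) * (3 / 2)"
    using rho_le_three_halves by (intro mult_left_mono) auto
  moreover have "real \<tau> * (5 / 2) \<le> real \<tau> * exp 1"
    using exp_1_ge by (intro mult_left_mono) auto
  \<comment> \<open>One of the four copies of \<open>c\<close> covers \<open>b\<close>; the other
    three give \<open>15 / 2 * t\<close>, which is at least \<open>6 + 3 / 2 * t\<close> exactly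
    when \<open>1 \<le> t\<close>.\<close>
  moreover have "a + b \<le> 4 * c" if "b \<le> c" "a \<le> (4 + t) * (3 / 2)" "t * (5 / 2) \<le> c" "1 \<le> t"
    for a b c t :: real
    using that by simp
  ultimately have "(4 + real \<tau>) * \<rho> + real \<tau> * (\<rho> * \<kappa>) \<le> 4 * (real \<tau> * exp 1)"
    using tau_ge_1 by blast
  then have "\<rho> * (4 + real \<tau> + real \<tau> * \<kappa>) \<le> 4 * exp 1 * real \<tau>"
    by (simp add: algebra_simps)
  then have "\<epsilon> * (\<rho> * (4 + real \<tau> + real \<tau> * \<kappa>)) \<le> \<epsilon> * (4 * exp 1 * real \<tau>)"
    using eps_pos by (intro mult_left_mono) auto
  then have "\<epsilon> * (4 + real \<tau> + real \<tau> * \<kappa>) * \<rho> \<le> \<rho> - 1"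
    by (simp add: \<rho>_def algebra_simps)
  then show ?thesis
    using rho_gt_1 by (simp add: field_simps)
qed

text \<open>The bracket is at most 4 and its prefactor \<open>\<epsilon> * \<tau> * \<kappa>\<close>
  at most 1/8, so the denominator does not exceed 3/2.\<close>

lemma steplength_le_inverse_psi:
  "1 / 2 \<le> 1 / (1 + Lres * real \<tau> * \<kappa> / (r * Lmax) * (2 + Lmax / (r * Lres) + 2 * real \<tau> / n))"
proof -
  have r1: "1 \<le> r"
    using n_ge_1 by simp
  have "Lmax / (r * Lres) \<le> 1"
    using mult_mono[OF r1 Lmax_le] Lmax_pos Lmax_le r_pos by (simp add: divide_le_eq)
  moreover have "2 * real \<tau> / n \<le> 1"
  proof -
    have "2 * real \<tau> / n \<le> 2 * real \<tau> / r"
      using r1 by (intro divide_left_mono) (use n_ge_1 in \<open>auto simp: real_le_lsqrt power2_eq_square\<close>)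
    also have "\<dots> \<le> 2 * (\<epsilon> * real \<tau>)"
      using mult_right_mono[OF inverse_r_le, of "real \<tau>"] by simp
    finally show ?thesis
      using eps_tau_le_8 by simp
  qed
  ultimately have b: "2 + Lmax / (r * Lres) + 2 * real \<tau> / n \<le> 4"
    by simp
  have e: "Lres * real \<tau> * \<kappa> / (r * Lmax) = \<epsilon> * real \<tau> * \<kappa>"
    by (simp add: \<epsilon>_def)
  have p: "0 \<le> Lmax / (r * Lres)"
    using Lmax_pos Lres_pos r_pos by simp
  have m: "0 \<le> 2 * real \<tau> / n"
    using n_ge_1 by simp
  have q: "0 \<le> \<epsilon> * real \<tau> * \<kappa>"
    using eps_pos kappa_ge_1 by simp
  have 1: "\<epsilon> * real \<tau> * \<kappa> * (2 + Lmax / (r * Lres) + 2 * real \<tau> / n) \<le> 1 / 8 * 4"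
    using b eps_tau_kappa_le q p m by (intro mult_mono) auto
  have 2: "0 \<le> \<epsilon> * real \<tau> * \<kappa> * (2 + Lmax / (r * Lres) + 2 * real \<tau> / n)"
    using p m by (intro mult_nonneg_nonneg[OF q]) auto
  have "1 / 2 \<le> 1 / (1 + z)" if "0 \<le> z" "z \<le> 1 / 8 * 4" for z :: real
    using that by (simp add: pos_le_divide_eq)
  from this[OF 2 1] show ?thesis
    unfolding e .
qed

text \<open>By \<open>rho_kappa_le\<close>, \<open>1 - 1 / \<rho>\<close> is at least
  \<open>4 * \<epsilon> * \<tau> * \<kappa>\<close>, and \<open>2 / r\<close> takes away at most
  half of that.\<close>

lemma steplength_le_second_bound:
  "1 / 2 \<le> (1 - 1 / \<rho> - 2 / r) * (r * Lmax / (4 * Lres * real \<tau> * \<kappa>))"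
proof -
  have q: "0 < 4 * \<epsilon> * real \<tau> * \<kappa>"
    using eps_pos kappa_ge_1 tau_ge_1 by simp
  have e: "r * Lmax / (4 * Lres * real \<tau> * \<kappa>) = 1 / (4 * \<epsilon> * real \<tau> * \<kappa>)"
    by (simp add: \<epsilon>_def)
  have "1 - 1 / \<rho> = 4 * exp 1 * real \<tau> * \<epsilon> / \<rho>"
    using rho_gt_1 by (simp add: \<rho>_def field_simps)
  moreover have "4 * real \<tau> * \<epsilon> * \<kappa> \<le> 4 * exp 1 * real \<tau> * \<epsilon> / \<rho>"
  proof -
    have "4 * real \<tau> * \<epsilon> * (\<rho> * \<kappa>) \<le> 4 * real \<tau> * \<epsilon> * exp 1"
      using rho_kappa_le eps_pos by (intro mult_left_mono) auto
    then show ?thesis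
      using rho_gt_1 by (simp add: field_simps)
  qed
  moreover have "2 / r \<le> 2 * \<epsilon>"
    using inverse_r_le by simp
  moreover have "2 * \<epsilon> * (1 * 1) \<le> 2 * \<epsilon> * (real \<tau> * \<kappa>)"
    using eps_pos tau_ge_1 kappa_ge_1 by (intro mult_left_mono mult_mono) auto
  ultimately have "1 / 2 * (4 * \<epsilon> * real \<tau> * \<kappa>) \<le> 1 - 1 / \<rho> - 2 / r"
    by (simp add: mult_ac)
  then show ?thesis
    unfolding e times_divide_eq_right mult_1_right pos_le_divide_eq[OF q] .
qed

section \<open>The iterates as functions of the choice sequence\<close>

text \<open>The \<open>min\<close> makes the recursion visibly well-founded; by \<open>k_le\<close>
  it equals \<open>k j\<close>.\<close>

fun X :: "(nat \<Rightarrow> 'n) \<Rightarrow> nat \<Rightarrow> real ^ 'n" where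
  "X i 0 = x0"
| "X i (Suc j) = closest_point \<Omega>
     (X i j - (1 / 2 / Lmax * grad f (X i (min (k j) j)) $ i j) *\<^sub>R axis (i j) 1)"

declare X.simps(2)[simp del]

text \<open>The update along all coordinates at once; an actual step of the iteration moves only
  one of them.\<close>

definition xbar :: "(nat \<Rightarrow> 'n) \<Rightarrow> nat \<Rightarrow> real ^ 'n"
  where "xbar i j = closest_point \<Omega> (X i j - (1 / (2 * Lmax)) *\<^sub>R grad f (X i (k j)))"

definition full_step :: "(nat \<Rightarrow> 'n) \<Rightarrow> nat \<Rightarrow> real ^ 'n"
  where "full_step i j = X i j - xbar i j"

text \<open>The length of the actual step, see \<open>norm_X_diff_Suc\<close>.\<close>

definition \<delta> :: "(nat \<Rightarrow> 'n) \<Rightarrow> nat \<Rightarrow> real"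
  where "\<delta> i j = \<bar>full_step i j $ i j\<bar>"

lemma k_le: "k j \<le> j"
  using delay by (simp add: bounded_delay_def)

lemma k_ge: "j - \<tau> \<le> k j"
  using delay by (auto simp: bounded_delay_def) (metis add.commute le_diff_conv)

lemma Omega_props: "closed \<Omega>" "convex \<Omega>" "\<Omega> \<noteq> {}"
  using J_closed J_convex x0 by (auto simp: Omega closed_coord_box convex_coord_box)

lemma X_in: "X i j \<in> \<Omega>"
  using x0 Omega_props by (cases j) (auto simp: X.simps closest_point_in_set)

text \<open>Causality, the source of all independence: whatever is computed from the iterates up to
  \<open>j\<close> is fixed before \<open>i j\<close> is drawn.\<close>

lemma X_cong: "(\<And>m. m < j \<Longrightarrow> i m = i' m) \<Longrightarrow> X i j = X i' j"
proof (induction j rule: less_induct)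
  case (less j)
  show ?case
  proof (cases j)
    case (Suc m)
    have "X i m = X i' m" "X i (min (k m) m) = X i' (min (k m) m)" "i m = i' m"
      using less Suc by auto
    then show ?thesis
      by (simp add: Suc X.simps)
  qed simp
qed

lemma X_upd: "j \<le> m \<Longrightarrow> X (i(m := c)) j = X i j"
  by (rule X_cong) auto

lemma full_step_upd: "j \<le> m \<Longrightarrow> full_step (i(m := c)) j = full_step i j"
  using X_upd[of j m i c] X_upd[of "k j" m i c] k_le[of j] by (simp add: full_step_def xbar_def)

lemma projection_component:
  "closest_point \<Omega> y $ c = closest_point (J c) (y $ c)"
  using Omega_props J_closed J_convex unfolding Omega by (intro closest_point_coord_box)

text \<open>The projection acts on each coordinate separately, and the coordinates not chosen
  already lie in their intervals.\<close>

lemma X_Suc: "X i (Suc j) = X i j - (full_step i j $ i j) *\<^sub>R axis (i j) 1"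
proof (rule vec_eq_iff[THEN iffD2], rule allI)
  fix c
  have "X i j $ c \<in> J c"
    using X_in by (simp add: Omega coord_box_def)
  then show "X i (Suc j) $ c = (X i j - (full_step i j $ i j) *\<^sub>R axis (i j) 1) $ c"
    using k_le[of j]
    by (cases "c = i j")
       (simp_all add: X.simps projection_component full_step_def xbar_def min_absorb1
          closest_point_self axis_def)
qed

section \<open>Estimates for a fixed choice sequence\<close>

lemma norm_X_diff_Suc: "norm (X i j - X i (Suc j)) = \<delta> i j"
  by (simp add: X_Suc \<delta>_def)

lemma norm_grad_diff_Suc: "norm (grad f (X i j) - grad f (X i (Suc j))) \<le> Lres * \<delta> i j"
proof -
  have "norm (grad f z - grad f (z + t *\<^sub>R axis c 1)) \<le> Lres * \<bar>t\<bar>"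
    if "z \<in> \<Omega>" "z + t *\<^sub>R axis c 1 \<in> \<Omega>" for z t c
    using restricted that by (auto simp: restricted_lipschitz_def)
  from this[of "X i j" "- (full_step i j $ i j)" "i j"] show ?thesis
    using X_in[of i j] X_in[of i "Suc j"] by (simp add: X_Suc \<delta>_def)
qed

lemma norm_X_diff: "p \<le> q \<Longrightarrow> norm (X i p - X i q) \<le> (\<Sum>d = p..<q. \<delta> i d)"
proof (induction q rule: dec_induct)
  case (step q)
  have "norm (X i p - X i (Suc q)) \<le> norm (X i p - X i q) + norm (X i q - X i (Suc q))"
    using norm_triangle_ineq[of "X i p - X i q" "X i q - X i (Suc q)"] by simp
  then show ?case
    using step by (simp add: norm_X_diff_Suc)
qed simp

lemma norm_grad_diff:
  "p \<le> q \<Longrightarrow> norm (grad f (X i p) - grad f (X i q)) \<le> Lres * (\<Sum>d = p..<q. \<delta> i d)"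
proof (induction q rule: dec_induct)
  case (step q)
  have "norm (grad f (X i p) - grad f (X i (Suc q)))
      \<le> norm (grad f (X i p) - grad f (X i q)) + norm (grad f (X i q) - grad f (X i (Suc q)))"
    using norm_triangle_ineq[of "grad f (X i p) - grad f (X i q)" "grad f (X i q) - grad f (X i (Suc q))"]
    by simp
  then show ?case
    using step norm_grad_diff_Suc[of i q] by (simp add: distrib_left)
qed simp

lemma delta_nonneg: "0 \<le> \<delta> i j"
  by (simp add: \<delta>_def)

text \<open>Read times need not be monotone: \<open>k j\<close> and \<open>k (Suc j)\<close> can
  come in either order, so the bound covers a window containing both.\<close>

lemma norm_grad_diff_window:
  assumes "lo \<le> p" "p \<le> hi" "lo \<le> q" "q \<le> hi"
  shows "norm (grad f (X i p) - grad f (X i q)) \<le> Lres * (\<Sum>d = lo..<hi. \<delta> i d)"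
proof -
  have *: "norm (grad f (X i p) - grad f (X i q)) \<le> Lres * (\<Sum>d = lo..<hi. \<delta> i d)"
    if "p \<le> q" "lo \<le> p" "q \<le> hi" for p q
  proof -
    have "(\<Sum>d = p..<q. \<delta> i d) \<le> (\<Sum>d = lo..<hi. \<delta> i d)"
      using that by (intro sum_mono2) (auto simp: delta_nonneg)
    then have "Lres * (\<Sum>d = p..<q. \<delta> i d) \<le> Lres * (\<Sum>d = lo..<hi. \<delta> i d)"
      using Lmax_pos Lmax_le by (intro mult_left_mono) auto
    then show ?thesis
      using norm_grad_diff[OF \<open>p \<le> q\<close>, of i] by linarith
  qed
  show ?thesis
    using *[of p q] *[of q p] assms by (cases "p \<le> q") (auto simp: norm_minus_commute)
qed

text \<open>Using that the residual of the projection is nonexpansive, and not only the projection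
  itself, makes the displacement of the iterate enter with factor one instead of two.\<close>

lemma full_step_change:
  "(norm (full_step i j))\<^sup>2 - (norm (full_step i (Suc j)))\<^sup>2
     \<le> 2 * norm (full_step i j) * (\<delta> i j + Lres / Lmax * (\<Sum>d = j - \<tau>..j. \<delta> i d))"
proof -
  define s where "s = 1 / (2 * Lmax)"
  define u where "u m = X i m - s *\<^sub>R grad f (X i (k m))" for m
  define w where "w = grad f (X i (k j)) - grad f (X i (k (Suc j)))"
  have s: "0 < s" and s2: "2 * s * (Lres * t) = Lres / Lmax * t" for t
    using Lmax_pos by (auto simp: s_def)
  have fs: "full_step i m = (u m - closest_point \<Omega> (u m)) + s *\<^sub>R grad f (X i (k m))" for m
    by (simp add: full_step_def xbar_def u_def s_def)
  have "full_step i j - full_step i (Suc j)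
      = ((u j - closest_point \<Omega> (u j)) - (u (Suc j) - closest_point \<Omega> (u (Suc j)))) + s *\<^sub>R w"
    unfolding fs w_def by (simp add: algebra_simps)
  then have "norm (full_step i j - full_step i (Suc j)) \<le> norm (u j - u (Suc j)) + s * norm w"
    using norm_triangle_ineq closest_point_residual_nonexpansive[OF Omega_props(2,1,3)] s
    by (smt (verit) norm_scaleR)
  moreover have "norm (u j - u (Suc j)) \<le> \<delta> i j + s * norm w"
  proof -
    have "u j - u (Suc j) = (X i j - X i (Suc j)) - s *\<^sub>R w"
      unfolding u_def w_def by (simp add: algebra_simps)
    then show ?thesis
      using norm_triangle_ineq4[of "X i j - X i (Suc j)" "s *\<^sub>R w"] s by (simp add: norm_X_diff_Suc)
  qed
  \<comment> \<open>The gradient change \<open>w\<close> enters twice, through \<open>u\<close> and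
    through the explicit gradient term; \<open>2 * s\<close> is \<open>1 / Lmax\<close>.\<close>
  moreover have "2 * s * norm w \<le> 2 * s * (Lres * (\<Sum>d = j - \<tau>..j. \<delta> i d))"
  proof -
    have "norm w \<le> Lres * (\<Sum>d = j - \<tau>..<Suc j. \<delta> i d)"
      unfolding w_def using k_le[of j] k_ge[of j] k_le[of "Suc j"] k_ge[of "Suc j"]
      by (intro norm_grad_diff_window) auto
    then show ?thesis
      using s by (intro mult_left_mono) (auto simp: atLeastLessThanSuc_atLeastAtMost)
  qed
  ultimately have d: "norm (full_step i j - full_step i (Suc j))
      \<le> \<delta> i j + Lres / Lmax * (\<Sum>d = j - \<tau>..j. \<delta> i d)"
    unfolding s2 by linarith
  let ?a = "norm (full_step i j)" and ?b = "norm (full_step i (Suc j))"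
  \<comment> \<open>In this form only \<open>?a\<close> remains as a factor, and it does not depend
    on the choice \<open>i j\<close>.\<close>
  have "?a\<^sup>2 - ?b\<^sup>2 = 2 * ?a * (?a - ?b) - (?a - ?b)\<^sup>2"
    by (simp add: power2_eq_square algebra_simps)
  also have "\<dots> \<le> 2 * ?a * (?a - ?b)"
    by simp
  also have "\<dots> \<le> 2 * ?a * norm (full_step i j - full_step i (Suc j))"
    by (intro mult_left_mono norm_triangle_ineq2) auto
  also have "\<dots> \<le> 2 * ?a * (\<delta> i j + Lres / Lmax * (\<Sum>d = j - \<tau>..j. \<delta> i d))"
    using d by (intro mult_left_mono) auto
  finally show ?thesis .
qed

text \<open>The obtuse-angle criterion for the projection onto the interval \<open>J c\<close>,
  scaled by the inverse of the steplength \<open>1 / (2 * Lmax)\<close>.\<close>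

lemma projection_variational:
  assumes "y \<in> \<Omega>"
  shows "2 * Lmax * (full_step i j $ c) * (y $ c - xbar i j $ c)
    \<le> grad f (X i (k j)) $ c * (y $ c - xbar i j $ c)"
proof -
  let ?u = "X i j - (1 / (2 * Lmax)) *\<^sub>R grad f (X i (k j))"
  have "(?u $ c - closest_point (J c) (?u $ c)) \<bullet> (y $ c - closest_point (J c) (?u $ c)) \<le> 0"
    using assms J_convex J_closed by (intro closest_point_dot) (auto simp: Omega coord_box_def)
  moreover have "closest_point (J c) (?u $ c) = xbar i j $ c"
    by (simp add: xbar_def projection_component)
  moreover have "?u $ c - xbar i j $ c = full_step i j $ c - 1 / (2 * Lmax) * grad f (X i (k j)) $ c"
    by (simp add: full_step_def)
  ultimately have "(full_step i j $ c - 1 / (2 * Lmax) * grad f (X i (k j)) $ c)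
      * (y $ c - xbar i j $ c) \<le> 0"
    by (simp only: inner_real_def)
  then have "2 * Lmax * ((full_step i j $ c - 1 / (2 * Lmax) * grad f (X i (k j)) $ c)
      * (y $ c - xbar i j $ c)) \<le> 2 * Lmax * 0"
    using Lmax_pos by (intro mult_left_mono) auto
  moreover have "2 * Lmax * ((a - 1 / (2 * Lmax) * b) * z) = 2 * Lmax * a * z - b * z" for a b z
    using Lmax_pos by (simp add: field_simps)
  ultimately show ?thesis
    by (simp only: mult_zero_right diff_le_0_iff_le)
qed

lemma coordinate_descent:
  "f (X i (Suc j)) \<le> f (X i j) - full_step i j $ i j * grad f (X i j) $ i j
     + Lmax / 2 * (\<delta> i j)\<^sup>2"
proof -
  have "f (z + t *\<^sub>R axis c 1) - f z \<le> grad f z $ c * t + Lmax / 2 * t\<^sup>2"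
    if "z \<in> \<Omega>" "z + t *\<^sub>R axis c 1 \<in> \<Omega>" for z t c
    using coord that by (auto simp: coord_lipschitz_def)
  from this[of "X i j" "- (full_step i j $ i j)" "i j"] show ?thesis
    using X_in[of i j] X_in[of i "Suc j"] by (simp add: X_Suc \<delta>_def mult.commute)
qed

section \<open>Mean squares of the full steps\<close>

text \<open>The horizon \<open>N\<close> is kept fixed so that quantities of different times are
  averaged over the same sequences.\<close>

definition A :: "nat \<Rightarrow> nat \<Rightarrow> real"
  where "A N j = seq_mean N (\<lambda>i. (norm (full_step i j))\<^sup>2)"

lemma A_nonneg: "0 \<le> A N j"
  by (simp add: A_def seq_mean_nonneg)

text \<open>Both vectors are fixed before \<open>i j\<close> is drawn, so the uniform average over
  the chosen coordinate produces their inner product.\<close>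

lemma mean_chosen_inner:
  fixes v w :: "(nat \<Rightarrow> 'n) \<Rightarrow> real ^ 'n"
  assumes "j < N"
    and "\<And>i c. v (i(j := c)) = v i" and "\<And>i c. w (i(j := c)) = w i"
  shows "seq_mean N (\<lambda>i. v i $ i j * w i $ i j) = seq_mean N (\<lambda>i. v i \<bullet> w i) / n"
  unfolding n using assms
  by (subst seq_mean_resample[where H = "\<lambda>i c. v i $ c * w i $ c"]) (auto simp: inner_vec_def)

lemma mean_delta_square:
  assumes "j < N"
  shows "seq_mean N (\<lambda>i. (\<delta> i j)\<^sup>2) = A N j / n"
  using mean_chosen_inner[OF assms, of "\<lambda>i. full_step i j" "\<lambda>i. full_step i j"]
  unfolding A_def \<delta>_def power2_norm_eq_inner power2_abs
  by (simp add: power2_eq_square full_step_upd)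

text \<open>Young's inequality with weight \<open>r\<close>, which balances the terms:
  \<open>r * \<delta> i d\<close> has mean square \<open>A N d\<close>.\<close>

lemma mean_norm_delta:
  assumes "d < N"
  shows "seq_mean N (\<lambda>i. norm (full_step i j) * \<delta> i d) \<le> (A N j + A N d) / (2 * r)"
proof -
  have r2: "r\<^sup>2 = n"
    using n_ge_1 by simp
  have "norm (full_step i j) * \<delta> i d \<le> 1 / (2 * r) * ((norm (full_step i j))\<^sup>2 + n * (\<delta> i d)\<^sup>2)" for i
  proof -
    have "0 \<le> (norm (full_step i j) - r * \<delta> i d)\<^sup>2"
      by simp
    also have "\<dots> = (norm (full_step i j))\<^sup>2 + n * (\<delta> i d)\<^sup>2 - 2 * r * (norm (full_step i j) * \<delta> i d)"
      unfolding power2_diff power_mult_distrib r2 by (simp add: mult_ac)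
    finally show ?thesis
      using r_pos by (simp add: pos_le_divide_eq mult_ac)
  qed
  then have "seq_mean N (\<lambda>i. norm (full_step i j) * \<delta> i d)
      \<le> 1 / (2 * r) * seq_mean N (\<lambda>i. (norm (full_step i j))\<^sup>2 + n * (\<delta> i d)\<^sup>2)"
    unfolding seq_mean_cmult[symmetric] by (rule seq_mean_mono)
  also have "\<dots> = (A N j + A N d) / (2 * r)"
    using n_ge_1 by (simp add: seq_mean_add seq_mean_cmult mean_delta_square[OF assms] A_def[symmetric])
  finally show ?thesis .
qed

text \<open>The growth bound is assumed only before \<open>j\<close>, so that this can be used
  inside the strong induction of \<open>A_growth\<close>.\<close>

lemma A_le_power:
  assumes step: "\<And>m. m < j \<Longrightarrow> A N m \<le> \<rho> * A N (Suc m)"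
    and "d \<le> j" "j \<le> d + \<tau>"
  shows "A N d \<le> \<kappa> * A N j"
proof -
  have "A N (j - t) \<le> \<rho> ^ t * A N j" if "t \<le> j" for t
    using that
  proof (induction t)
    case (Suc t)
    have "A N (j - Suc t) \<le> \<rho> * A N (Suc (j - Suc t))"
      using Suc.prems by (intro step) auto
    also have "Suc (j - Suc t) = j - t"
      using Suc.prems by simp
    also have "\<rho> * A N (j - t) \<le> \<rho> * (\<rho> ^ t * A N j)"
      using Suc rho_gt_1 by (intro mult_left_mono) auto
    finally show ?case
      by simp
  qed simp
  from this[of "j - d"] have "A N d \<le> \<rho> ^ (j - d) * A N j"
    using assms by simp
  also have "\<dots> \<le> \<kappa> * A N j"
    using assms rho_gt_1 A_nonneg by (intro mult_right_mono power_increasing) auto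
  finally show ?thesis .
qed

text \<open>The induction hypothesis bounds each \<open>A N d\<close> in the delay window by
  \<open>\<kappa> * A N j\<close>; averaging \<open>full_step_change\<close> then bounds the loss in
  one step by a multiple of \<open>A N j\<close>.\<close>

lemma A_growth: "j < N \<Longrightarrow> A N j \<le> \<rho> * A N (Suc j)"
proof (induction j rule: less_induct)
  case (less j)
  let ?W = "{j - \<tau>..j}"
  have past: "A N d \<le> \<kappa> * A N j" if "d \<le> j" "j \<le> d + \<tau>" for d
    using less that by (intro A_le_power) auto
  have "A N j - A N (Suc j) \<le> seq_mean N (\<lambda>i. 2 * (norm (full_step i j) * \<delta> i j)
      + 2 * (Lres / Lmax) * (\<Sum>d \<in> ?W. norm (full_step i j) * \<delta> i d))"
    unfolding A_def seq_mean_diff[symmetric] using full_step_change[of _ j]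
    by (intro seq_mean_mono) (simp add: distrib_left sum_distrib_left mult_ac)
  also have "\<dots> = 2 * seq_mean N (\<lambda>i. norm (full_step i j) * \<delta> i j)
      + 2 * (Lres / Lmax) * (\<Sum>d \<in> ?W. seq_mean N (\<lambda>i. norm (full_step i j) * \<delta> i d))"
    by (simp only: seq_mean_add seq_mean_cmult seq_mean_sum)
  also have "\<dots> \<le> 2 * ((A N j + A N j) / (2 * r))
      + 2 * (Lres / Lmax) * (\<Sum>d \<in> ?W. (A N j + A N d) / (2 * r))"
    using less.prems Lmax_pos Lres_pos
    by (intro add_mono mult_left_mono sum_mono mean_norm_delta) auto
  also have "\<dots> = 2 * (1 / r) * A N j + \<epsilon> * (\<Sum>d \<in> ?W. A N j + A N d)"
    using Lmax_pos r_pos by (simp add: \<epsilon>_def sum_divide_distrib[symmetric])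
  also have "\<dots> \<le> 2 * \<epsilon> * A N j + \<epsilon> * ((2 + real \<tau> * (1 + \<kappa>)) * A N j)"
  proof (intro add_mono mult_left_mono mult_right_mono)
    \<comment> \<open>The index \<open>j\<close> itself costs no factor \<open>\<kappa>\<close>; at
      most \<open>\<tau>\<close> others remain, fewer if the window is cut off at 0.\<close>
    have "?W = insert j {j - \<tau>..<j}"
      by auto
    then have "(\<Sum>d \<in> ?W. A N j + A N d) = 2 * A N j + (\<Sum>d = j - \<tau>..<j. A N j + A N d)"
      by simp
    also have "(\<Sum>d = j - \<tau>..<j. A N j + A N d) \<le> (\<Sum>d = j - \<tau>..<j. (1 + \<kappa>) * A N j)"
      using past by (intro sum_mono) (simp add: distrib_right le_diff_conv)
    also have "\<dots> \<le> real \<tau> * ((1 + \<kappa>) * A N j)"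
      using kappa_ge_1 A_nonneg by (simp add: mult_right_mono)
    finally show "(\<Sum>d \<in> ?W. A N j + A N d) \<le> (2 + real \<tau> * (1 + \<kappa>)) * A N j"
      by (simp add: algebra_simps)
  qed (use inverse_r_le eps_pos A_nonneg in auto)
  also have "\<dots> = \<epsilon> * (4 + real \<tau> + real \<tau> * \<kappa>) * A N j"
    by (simp add: algebra_simps)
  also have "\<dots> \<le> (1 - 1 / \<rho>) * A N j"
    by (intro mult_right_mono rho_contraction A_nonneg)
  finally have "A N j / \<rho> \<le> A N (Suc j)"
    by (simp add: algebra_simps)
  then show ?case
    using rho_gt_1 by (simp add: pos_divide_le_eq mult.commute)
qed

lemma A_past:
  assumes "j \<le> N" "d \<le> j" "j \<le> d + \<tau>"
  shows "A N d \<le> \<kappa> * A N j"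
  using assms by (intro A_le_power A_growth) auto

lemma window_card: "real (card {k j..<j}) \<le> real \<tau>"
  using k_ge[of j] by simp

lemma mean_norm_window:
  assumes "j \<le> N"
  shows "seq_mean N (\<lambda>i. norm (full_step i j) * (\<Sum>d = k j..<j. \<delta> i d)) \<le> real \<tau> * \<kappa> / r * A N j"
proof -
  have "seq_mean N (\<lambda>i. norm (full_step i j) * (\<Sum>d = k j..<j. \<delta> i d))
      = (\<Sum>d = k j..<j. seq_mean N (\<lambda>i. norm (full_step i j) * \<delta> i d))"
    by (simp add: sum_distrib_left seq_mean_sum)
  also have "\<dots> \<le> (\<Sum>d = k j..<j. \<kappa> / r * A N j)"
  proof (rule sum_mono)
    fix d assume d: "d \<in> {k j..<j}"
    have "A N d \<le> \<kappa> * A N j"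
      using d assms k_ge[of j] by (intro A_past) auto
    moreover have "1 * A N j \<le> \<kappa> * A N j"
      using kappa_ge_1 A_nonneg by (intro mult_right_mono) auto
    ultimately have "(A N j + A N d) / (2 * r) \<le> (\<kappa> * A N j + \<kappa> * A N j) / (2 * r)"
      using r_pos by (intro divide_right_mono) auto
    then show "seq_mean N (\<lambda>i. norm (full_step i j) * \<delta> i d) \<le> \<kappa> / r * A N j"
      using mean_norm_delta[of d N j] d assms by simp
  qed
  also have "\<dots> \<le> real \<tau> * (\<kappa> / r * A N j)"
    unfolding sum_constant using kappa_ge_1 A_nonneg r_pos
    by (intro mult_right_mono window_card mult_nonneg_nonneg) auto
  finally show ?thesis
    by simp
qed

lemma mean_window_square:
  assumes "j \<le> N"
  shows "seq_mean N (\<lambda>i. (\<Sum>d = k j..<j. \<delta> i d)\<^sup>2) \<le> (real \<tau>)\<^sup>2 * \<kappa> / n * A N j"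
proof -
  \<comment> \<open>Cauchy-Schwarz for a sum of at most \<open>\<tau>\<close> terms.\<close>
  have "(\<Sum>d = k j..<j. \<delta> i d)\<^sup>2 \<le> real \<tau> * (\<Sum>d = k j..<j. (\<delta> i d)\<^sup>2)" for i
  proof -
    have "(\<Sum>d = k j..<j. \<delta> i d)\<^sup>2 \<le> (\<Sum>d = k j..<j. (\<delta> i d)\<^sup>2) * real (card {k j..<j})"
      using sum_squared_le_sum_of_squares[of "\<delta> i" "{k j..<j}"] by simp
    also have "\<dots> \<le> (\<Sum>d = k j..<j. (\<delta> i d)\<^sup>2) * real \<tau>"
      by (intro mult_left_mono window_card sum_nonneg) auto
    finally show ?thesis
      by (simp add: mult.commute)
  qed
  then have "seq_mean N (\<lambda>i. (\<Sum>d = k j..<j. \<delta> i d)\<^sup>2)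
      \<le> seq_mean N (\<lambda>i. real \<tau> * (\<Sum>d = k j..<j. (\<delta> i d)\<^sup>2))"
    by (rule seq_mean_mono)
  also have "\<dots> = real \<tau> * (\<Sum>d = k j..<j. A N d / n)"
    using assms by (auto simp: seq_mean_cmult seq_mean_sum mean_delta_square intro!: sum.cong)
  also have "\<dots> \<le> real \<tau> * (\<Sum>d = k j..<j. \<kappa> * A N j / n)"
    using assms k_ge[of j] n_ge_1
    by (intro mult_left_mono sum_mono divide_right_mono A_past) auto
  also have "\<dots> \<le> real \<tau> * (real \<tau> * (\<kappa> * A N j / n))"
    using window_card kappa_ge_1 A_nonneg n_ge_1
    by (intro mult_left_mono) (simp_all add: mult_right_mono divide_right_mono del: card_atLeastLessThan)
  finally show ?thesis
    by (simp add: power2_eq_square mult_ac)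
qed

section \<open>Stale gradients and the decrease of the mean objective\<close>

definition stale_error :: "(nat \<Rightarrow> 'n) \<Rightarrow> nat \<Rightarrow> real"
  where "stale_error i j
    = full_step i j $ i j * (grad f (X i (k j)) - grad f (X i j)) $ i j"

text \<open>Averaging over \<open>i j\<close> gives an inner product, and Cauchy-Schwarz reduces it
  to \<open>mean_norm_window\<close>. The result is small against the quadratic decrease, a fixed
  multiple of \<open>Lmax * A N j / n\<close>.\<close>

lemma mean_stale_error:
  assumes "j < N"
  shows "seq_mean N (\<lambda>i. stale_error i j) \<le> Lmax / 8 * (A N j / n)"
proof -
  have "seq_mean N (\<lambda>i. stale_error i j)
      = seq_mean N (\<lambda>i. full_step i j \<bullet> (grad f (X i (k j)) - grad f (X i j))) / n"
    unfolding stale_error_def using k_le[of j]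
    by (intro mean_chosen_inner assms) (simp_all add: full_step_upd X_upd)
  also have "\<dots> \<le> seq_mean N (\<lambda>i. Lres * (norm (full_step i j) * (\<Sum>d = k j..<j. \<delta> i d))) / n"
  proof (intro divide_right_mono seq_mean_mono)
    fix i
    have "full_step i j \<bullet> (grad f (X i (k j)) - grad f (X i j))
        \<le> norm (full_step i j) * norm (grad f (X i (k j)) - grad f (X i j))"
      by (rule norm_cauchy_schwarz)
    also have "\<dots> \<le> norm (full_step i j) * (Lres * (\<Sum>d = k j..<j. \<delta> i d))"
      by (intro mult_left_mono norm_grad_diff k_le) auto
    finally show "full_step i j \<bullet> (grad f (X i (k j)) - grad f (X i j))
        \<le> Lres * (norm (full_step i j) * (\<Sum>d = k j..<j. \<delta> i d))"
      by (simp add: mult_ac)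
  qed (use n_ge_1 in auto)
  also have "\<dots> \<le> Lres * (real \<tau> * \<kappa> / r * A N j) / n"
    unfolding seq_mean_cmult using assms n_ge_1 Lres_pos
    by (intro divide_right_mono mult_left_mono mean_norm_window) auto
  also have "\<dots> = (Lres / r) * (real \<tau> * \<kappa>) * (A N j / n)"
    by simp
  also have "\<dots> = Lmax * (\<epsilon> * real \<tau> * \<kappa>) * (A N j / n)"
    by (simp add: Lres_eq mult_ac)
  also have "\<dots> \<le> Lmax * (1 / 8) * (A N j / n)"
    using Lmax_pos A_nonneg n_ge_1 by (intro mult_right_mono mult_left_mono eps_tau_kappa_le) auto
  finally show ?thesis
    by simp
qed

lemma mean_f_decreasing:
  assumes "j < N"
  shows "seq_mean N (\<lambda>i. f (X i (Suc j))) \<le> seq_mean N (\<lambda>i. f (X i j))"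
proof -
  \<comment> \<open>The projection inequality with \<open>y = X i j\<close> gains
    \<open>2 * Lmax\<close>, and the quadratic term of the coordinate Lipschitz bound costs
    \<open>Lmax / 2\<close>.\<close>
  have "f (X i (Suc j)) \<le> f (X i j) - 3 / 2 * Lmax * (\<delta> i j)\<^sup>2 + stale_error i j" for i
  proof -
    have s: "X i j $ i j - xbar i j $ i j = full_step i j $ i j"
      by (simp add: full_step_def)
    have "2 * Lmax * (\<delta> i j)\<^sup>2 \<le> full_step i j $ i j * grad f (X i (k j)) $ i j"
      using projection_variational[OF X_in[of i j], of i j "i j"] unfolding s
      by (simp add: \<delta>_def power2_eq_square mult_ac)
    then show ?thesis
      using coordinate_descent[of i j] by (simp add: stale_error_def algebra_simps)
  qed
  then have "seq_mean N (\<lambda>i. f (X i (Suc j)))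
      \<le> seq_mean N (\<lambda>i. f (X i j) - 3 / 2 * Lmax * (\<delta> i j)\<^sup>2 + stale_error i j)"
    by (rule seq_mean_mono)
  also have "\<dots> = seq_mean N (\<lambda>i. f (X i j)) - 3 / 2 * Lmax * (A N j / n) + seq_mean N (\<lambda>i. stale_error i j)"
    by (simp only: seq_mean_add seq_mean_diff seq_mean_cmult mean_delta_square[OF assms])
  also have "\<dots> \<le> seq_mean N (\<lambda>i. f (X i j)) - 11 / 8 * (Lmax * (A N j / n))"
    using mean_stale_error[OF assms] by simp
  also have "\<dots> \<le> seq_mean N (\<lambda>i. f (X i j))"
    using Lmax_pos A_nonneg n_ge_1 by simp
  finally show ?thesis .
qed

section \<open>The Lyapunov function\<close>

abbreviation S :: "(real ^ 'n) set" where "S \<equiv> minimizers f \<Omega>"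

abbreviation fmin :: real where "fmin \<equiv> opt_value f \<Omega>"

abbreviation P :: "real ^ 'n \<Rightarrow> real ^ 'n" where "P \<equiv> closest_point S"

lemma closed_S: "closed S"
proof (rule closed_minimizers)
  show "continuous_on \<Omega> f"
    by (rule differentiable_imp_continuous_on)
       (auto simp: differentiable_on_def intro: differentiable differentiable_at_withinI)
qed (rule Omega_props)

lemma P_in: "P z \<in> S" "P z \<in> \<Omega>"
  using closest_point_in_set[OF closed_S minimizers_ne] by (auto simp: minimizers_def)

lemma f_P: "f (P z) = fmin"
  using opt_value_eq[OF P_in(1)] by simp

text \<open>The new distance is compared with that to the old projection point. The quadratic
  coefficients, in units of \<open>Lmax\<close>, are 1 from the squared distance, 1/2 from the
  coordinate Lipschitz bound and -2 from the projection inequality.\<close>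

lemma lyapunov_pointwise:
  "Lmax * (norm (X i (Suc j) - P (X i (Suc j))))\<^sup>2 + f (X i (Suc j))
    \<le> Lmax * (norm (X i j - P (X i j)))\<^sup>2 + f (X i j) - Lmax / 2 * (\<delta> i j)\<^sup>2
      + grad f (X i (k j)) $ i j * (P (X i j) - X i j) $ i j + stale_error i j"
proof -
  let ?x = "X i j" and ?x' = "X i (Suc j)" and ?c = "i j"
  let ?w = "P ?x" and ?s = "full_step i j $ i j" and ?g = "grad f (X i (k j)) $ i j"
  have xb: "xbar i j $ ?c = ?x $ ?c - ?s"
    by (simp add: full_step_def)
  have "norm (?x' - P ?x') \<le> norm (?x' - ?w)"
    using closest_point_le[OF closed_S P_in(1), of ?x'] by (simp add: dist_norm)
  then have "(norm (?x' - P ?x'))\<^sup>2 \<le> (norm (?x' - ?w))\<^sup>2"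
    by (simp add: power_mono)
  also have "?x' - ?w = (?x - ?w) - ?s *\<^sub>R axis ?c 1"
    by (simp add: X_Suc)
  also have "(norm \<dots>)\<^sup>2 = (norm (?x - ?w))\<^sup>2 - 2 * ?s * (?x $ ?c - ?w $ ?c) + ?s\<^sup>2"
    unfolding power2_norm_eq_inner
    by (simp add: inner_diff_left inner_diff_right inner_axis inner_axis' inner_axis_axis power2_eq_square
          inner_commute algebra_simps)
  finally have "Lmax * (norm (?x' - P ?x'))\<^sup>2
      \<le> Lmax * ((norm (?x - ?w))\<^sup>2 - 2 * ?s * (?x $ ?c - ?w $ ?c) + ?s\<^sup>2)"
    using Lmax_pos by (intro mult_left_mono) auto
  moreover have "2 * Lmax * ?s * (?w $ ?c - ?x $ ?c + ?s) \<le> ?g * (?w $ ?c - ?x $ ?c + ?s)"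
    using projection_variational[OF P_in(2), of i j ?c ?x] unfolding xb by (simp add: algebra_simps)
  ultimately show ?thesis
    using coordinate_descent[of i j]
    by (simp add: stale_error_def \<delta>_def power2_eq_square algebra_simps)
qed

text \<open>Convexity is used twice, from the stale point towards the minimizer and from the current
  point towards the stale one. The remainder pairs a gradient difference with a displacement, so it
  is quadratic in the window sum.\<close>

lemma stale_grad_inner:
  "grad f (X i (k j)) \<bullet> (P (X i j) - X i j) \<le> fmin - f (X i j) + Lres * (\<Sum>d = k j..<j. \<delta> i d)\<^sup>2"
proof -
  let ?x = "X i j" and ?z = "X i (k j)" and ?\<sigma> = "\<Sum>d = k j..<j. \<delta> i d"
  have "grad f ?z \<bullet> (P ?x - ?x) = grad f ?z \<bullet> (P ?x - ?z) + grad f ?x \<bullet> (?z - ?x)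
      + (grad f ?z - grad f ?x) \<bullet> (?z - ?x)"
    by (simp add: inner_diff_left inner_diff_right)
  also have "\<dots> \<le> (f (P ?x) - f ?z) + (f ?z - f ?x) + (Lres * ?\<sigma>) * ?\<sigma>"
  proof (intro add_mono)
    have "(grad f ?z - grad f ?x) \<bullet> (?z - ?x) \<le> norm (grad f ?z - grad f ?x) * norm (?z - ?x)"
      by (rule norm_cauchy_schwarz)
    also have "\<dots> \<le> (Lres * ?\<sigma>) * ?\<sigma>"
      using Lres_pos
      by (intro mult_mono norm_grad_diff norm_X_diff k_le mult_nonneg_nonneg sum_nonneg)
         (auto simp: delta_nonneg)
    finally show "(grad f ?z - grad f ?x) \<bullet> (?z - ?x) \<le> (Lres * ?\<sigma>) * ?\<sigma>" .
  qed (use X_in P_in differentiable convex_f in \<open>auto intro!: convex_on_grad_le\<close>)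
  finally show ?thesis
    by (simp add: f_P power2_eq_square)
qed

definition F :: "nat \<Rightarrow> nat \<Rightarrow> real"
  where "F N j = seq_mean N (\<lambda>i. f (X i j)) - fmin"

definition D :: "nat \<Rightarrow> nat \<Rightarrow> real"
  where "D N j = seq_mean N (\<lambda>i. (norm (X i j - P (X i j)))\<^sup>2)"

lemma F_antimono: "j < N \<Longrightarrow> F N (Suc j) \<le> F N j"
  by (simp add: F_def mean_f_decreasing)

lemma D_nonneg: "0 \<le> D N j"
  by (simp add: D_def seq_mean_nonneg)

lemma Lmax_D_nonneg: "0 \<le> Lmax * D N j"
  using Lmax_pos D_nonneg by simp

lemma lyapunov_decrease:
  assumes "j < N"
  shows "Lmax * D N (Suc j) + F N (Suc j) \<le> Lmax * D N j + F N j - F N j / n"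
proof -
  have "seq_mean N (\<lambda>i. grad f (X i (k j)) $ i j * (P (X i j) - X i j) $ i j)
      = seq_mean N (\<lambda>i. grad f (X i (k j)) \<bullet> (P (X i j) - X i j)) / n"
    using k_le[of j] by (intro mean_chosen_inner assms) (simp_all add: X_upd)
  also have "\<dots> \<le> seq_mean N (\<lambda>i. fmin - f (X i j) + Lres * (\<Sum>d = k j..<j. \<delta> i d)\<^sup>2) / n"
    using n_ge_1 by (intro divide_right_mono seq_mean_mono stale_grad_inner) auto
  also have "\<dots> = (- F N j + Lres * seq_mean N (\<lambda>i. (\<Sum>d = k j..<j. \<delta> i d)\<^sup>2)) / n"
    by (simp add: F_def seq_mean_add seq_mean_diff seq_mean_cmult seq_mean_const)
  also have "\<dots> \<le> (- F N j + Lres * ((real \<tau>)\<^sup>2 * \<kappa> / n * A N j)) / n"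
    using n_ge_1 assms Lres_pos
    by (intro divide_right_mono add_left_mono mult_left_mono mean_window_square) auto
  also have "\<dots> = - F N j / n + (Lres * (real \<tau>)\<^sup>2 * \<kappa> / n) * (A N j / n)"
    by (simp add: diff_divide_distrib)
  also have "(Lres * (real \<tau>)\<^sup>2 * \<kappa> / n) * (A N j / n) \<le> Lmax / 64 * (A N j / n)"
  proof (rule mult_right_mono)
    \<comment> \<open>Splitting \<open>n\<close> as \<open>r * r\<close> leaves \<open>Lmax\<close>
      times two factors of at most 1/8 each.\<close>
    have "Lres * (real \<tau>)\<^sup>2 * \<kappa> / n = (Lres / r) * real \<tau> * \<kappa> * (1 / r * real \<tau>)"
      using n_ge_1 by (simp add: power2_eq_square field_simps)
    also have "\<dots> = Lmax * ((\<epsilon> * real \<tau> * \<kappa>) * (1 / r * real \<tau>))"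
      by (simp add: Lres_eq mult_ac)
    also have "\<dots> \<le> Lmax * (1 / 8 * (1 / 8))"
    proof (intro mult_left_mono mult_mono eps_tau_kappa_le)
      show "1 / r * real \<tau> \<le> 1 / 8"
        using mult_right_mono[OF inverse_r_le, of "real \<tau>"] eps_tau_le_8 by linarith
    qed (use Lmax_pos r_pos in auto)
    finally show "Lres * (real \<tau>)\<^sup>2 * \<kappa> / n \<le> Lmax / 64"
      by simp
  qed (use A_nonneg n_ge_1 in auto)
  finally have g: "seq_mean N (\<lambda>i. grad f (X i (k j)) $ i j * (P (X i j) - X i j) $ i j)
      \<le> - F N j / n + Lmax / 64 * (A N j / n)"
    by simp
  have "seq_mean N (\<lambda>i. Lmax * (norm (X i (Suc j) - P (X i (Suc j))))\<^sup>2 + f (X i (Suc j)))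
    \<le> seq_mean N (\<lambda>i. Lmax * (norm (X i j - P (X i j)))\<^sup>2 + f (X i j) - Lmax / 2 * (\<delta> i j)\<^sup>2
      + grad f (X i (k j)) $ i j * (P (X i j) - X i j) $ i j + stale_error i j)"
    by (intro seq_mean_mono lyapunov_pointwise)
  then have "Lmax * D N (Suc j) + F N (Suc j)
    \<le> Lmax * D N j + F N j - Lmax / 2 * (A N j / n)
      + seq_mean N (\<lambda>i. grad f (X i (k j)) $ i j * (P (X i j) - X i j) $ i j)
      + seq_mean N (\<lambda>i. stale_error i j)"
    by (simp only: seq_mean_add seq_mean_diff seq_mean_cmult mean_delta_square[OF assms] D_def F_def)
  \<comment> \<open>The surplus is 1/2 - 1/64 - 1/8 = 23/64.\<close>
  also have "\<dots> \<le> Lmax * D N j + F N j - F N j / n - 23 / 64 * (Lmax * (A N j / n))"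
    using g mean_stale_error[OF assms] by simp
  also have "\<dots> \<le> Lmax * D N j + F N j - F N j / n"
    using Lmax_pos A_nonneg n_ge_1 by simp
  finally show ?thesis .
qed

section \<open>Convergence rates\<close>

lemma lyapunov_start: "Lmax * D N 0 + F N 0 = Lmax * (norm (x0 - P x0))\<^sup>2 + f x0 - fmin"
  by (simp add: D_def F_def seq_mean_const)

text \<open>Adding \<open>j * F N j / n\<close> to the Lyapunov function keeps it nonincreasing: its
  decrease pays for the new summand, and \<open>F_antimono\<close> handles the old ones.\<close>

theorem sublinear_rate:
  "F N N \<le> n * (Lmax * (norm (x0 - P x0))\<^sup>2 + f x0 - fmin) / (real N + n)"
proof -
  have "Lmax * D N j + F N j + real j * F N j / n \<le> Lmax * D N 0 + F N 0" if "j \<le> N" for j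
    using that
  proof (induction j)
    case (Suc j)
    have "real (Suc j) * F N (Suc j) / n \<le> real (Suc j) * F N j / n"
      using Suc.prems n_ge_1 by (intro divide_right_mono mult_left_mono F_antimono) auto
    also have "\<dots> = F N j / n + real j * F N j / n"
      by (simp add: add_divide_distrib distrib_right)
    finally show ?case
      using Suc lyapunov_decrease[of j N] by simp
  qed simp
  from this[of N] have "F N N + real N * F N N / n \<le> Lmax * D N 0 + F N 0"
    using Lmax_D_nonneg[of N N] by simp
  then show ?thesis
    unfolding lyapunov_start using n_ge_1 by (simp add: field_simps)
qed

text \<open>Strong convexity bounds the squared distance by the gap, so \<open>F N j / n\<close> is
  a fixed fraction of the whole Lyapunov function.\<close>

theorem linear_rate:
  assumes "0 < l" and esc: "essentially_strongly_convex f \<Omega> l"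
  shows "F N N \<le> (1 - l / (n * (l + 2 * Lmax))) ^ N
    * (Lmax * (norm (x0 - P x0))\<^sup>2 + f x0 - fmin)"
proof -
  define c where "c = l / (n * (l + 2 * Lmax))"
  have "l / 2 * (norm (X i j - P (X i j)))\<^sup>2 \<le> f (X i j) - fmin" for i j
  proof -
    let ?x = "X i j"
    \<comment> \<open>The projection is idempotent, so the property applies to the pair of
      \<open>?x\<close> and \<open>P ?x\<close>.\<close>
    have "P ?x = P (P ?x)"
      using P_in(1) by (simp add: closest_point_self)
    then have "grad f (P ?x) \<bullet> (?x - P ?x) + l / 2 * (norm (?x - P ?x))\<^sup>2 \<le> f ?x - f (P ?x)"
      using esc X_in P_in(2) unfolding essentially_strongly_convex_def by blast
    moreover have "0 \<le> grad f (P ?x) \<bullet> (?x - P ?x)"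
      using Omega_props P_in X_in differentiable by (intro minimizer_grad_nonneg) auto
    ultimately show ?thesis
      by (simp add: f_P)
  qed
  then have "l / 2 * D N j \<le> seq_mean N (\<lambda>i. f (X i j) - fmin)" for j
    unfolding D_def seq_mean_cmult[symmetric] by (intro seq_mean_mono)
  then have D: "l * D N j \<le> 2 * F N j" for j
    by (simp add: F_def seq_mean_diff seq_mean_const mult.commute)
  \<comment> \<open>The factor \<open>l + 2 * Lmax\<close> in \<open>c\<close> comes from inserting
    \<open>l * D N j \<le> 2 * F N j\<close> into \<open>l\<close> times the Lyapunov
    function.\<close>
  have c: "c * (Lmax * D N j + F N j) \<le> F N j / n" for j
  proof -
    have "Lmax * (l * D N j) \<le> Lmax * (2 * F N j)"
      using D Lmax_pos by (intro mult_left_mono) auto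
    then have "l * (Lmax * D N j + F N j) \<le> F N j * (l + 2 * Lmax)"
      by (simp add: algebra_simps)
    then have "l * (Lmax * D N j + F N j) / (n * (l + 2 * Lmax)) \<le> F N j * (l + 2 * Lmax) / (n * (l + 2 * Lmax))"
      using n_ge_1 Lmax_pos \<open>0 < l\<close> by (intro divide_right_mono) auto
    then show ?thesis
      using Lmax_pos \<open>0 < l\<close> by (simp add: c_def)
  qed
  \<comment> \<open>This keeps \<open>1 - c\<close> nonnegative, as the induction below multiplies
    by it.\<close>
  have "c \<le> 1"
  proof -
    have "1 * (l + 0) \<le> n * (l + 2 * Lmax)"
      using n_ge_1 Lmax_pos \<open>0 < l\<close> by (intro mult_mono) auto
    then show ?thesis
      using n_ge_1 Lmax_pos \<open>0 < l\<close> by (simp add: c_def)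
  qed
  have "Lmax * D N j + F N j \<le> (1 - c) ^ j * (Lmax * D N 0 + F N 0)" if "j \<le> N" for j
    using that
  proof (induction j)
    case (Suc j)
    have "Lmax * D N (Suc j) + F N (Suc j) \<le> (1 - c) * (Lmax * D N j + F N j)"
      using lyapunov_decrease[of j N] c[of j] Suc.prems by (simp add: left_diff_distrib)
    also have "\<dots> \<le> (1 - c) * ((1 - c) ^ j * (Lmax * D N 0 + F N 0))"
      using Suc \<open>c \<le> 1\<close> by (intro mult_left_mono) auto
    finally show ?case
      by simp
  qed simp
  from this[of N] have "F N N \<le> (1 - c) ^ N * (Lmax * D N 0 + F N 0)"
    using Lmax_D_nonneg[of N N] by simp
  then show ?thesis
    by (simp only: lyapunov_start c_def)
qed

end

section \<open>Transfer to the probability space\<close>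

theorem corollary5:
  fixes J :: "'n::finite \<Rightarrow> real set"
    and \<Omega> U S :: "(real ^ 'n) set"
    and f :: "real ^ 'n \<Rightarrow> real"
    and L :: "'n \<Rightarrow> real"
    and Lres Lmax R0 \<rho> \<psi> \<gamma> n :: real
    and x0 :: "real ^ 'n"
    and \<tau> :: nat
    and k :: "nat \<Rightarrow> nat"
    and M :: "'w measure"
    and I :: "nat \<Rightarrow> 'w \<Rightarrow> 'n"
    and x :: "nat \<Rightarrow> 'w \<Rightarrow> real ^ 'n"
  assumes intervals: "\<And>c. closed (J c) \<and> is_interval (J c)"
    and Omega: "\<Omega> = coord_box J"
    and neighborhood: "open U" "\<Omega> \<subseteq> U"
    and convex: "convex_on U f"
    and smooth: "f differentiable_on U" "continuous_on U (grad f)"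
    and S: "S = minimizers f \<Omega>" "S \<noteq> {}"
    and Lres: "restricted_lipschitz f \<Omega> Lres"
    and L: "\<And>c. coord_lipschitz f \<Omega> c (L c)"
    and Lmax: "Lmax = Max (range L)" "Lmax \<le> Lres"
    and x0: "x0 \<in> \<Omega>"
    and R0: "R0 = norm (x0 - closest_point S x0)"
    and n: "n = real CARD('n)" "n \<ge> 5"
    and tau: "\<tau> \<ge> 1"
      "real \<tau> * (real \<tau> + 1) \<le> sqrt n * Lmax / (4 * exp 1 * Lres)"
    and rho: "\<rho> = 1 + 4 * exp 1 * real \<tau> * Lres / (sqrt n * Lmax)"
    and psi: "\<psi> = 1 + Lres * real \<tau> * \<rho> ^ \<tau> / (sqrt n * Lmax) *
                   (2 + Lmax / (sqrt n * Lres) + 2 * real \<tau> / n)"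
    and gamma: "\<gamma> = 1 / 2"
    and prob: "prob_space M"
    and choices: "uniform_coordinate_choices M I"
    and delay: "bounded_delay \<tau> k"
    and iteration: "async_coordinate_descent f \<Omega> Lmax \<gamma> x0 k M I x"
  shows "\<gamma> \<le> 1 / \<psi> \<and>
    \<gamma> \<le> (1 - 1 / \<rho> - 2 / sqrt n) * (sqrt n * Lmax / (4 * Lres * real \<tau> * \<rho> ^ \<tau>)) \<and>
    (\<forall>l > 0. essentially_strongly_convex f \<Omega> l \<longrightarrow>
       (\<forall>j \<ge> 1. (\<integral>\<omega>. (f (x j \<omega>) - opt_value f \<Omega>) \<partial>M)
          \<le> (1 - l / (n * (l + 2 * Lmax))) ^ j *
             (Lmax * R0\<^sup>2 + f x0 - opt_value f \<Omega>))) \<and>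
    (\<forall>j \<ge> 1. (\<integral>\<omega>. (f (x j \<omega>) - opt_value f \<Omega>) \<partial>M)
       \<le> n * (Lmax * R0\<^sup>2 + f x0 - opt_value f \<Omega>) / (real j + n))"
proof -
  have r_pos: "0 < sqrt n"
    using n by simp
  have "0 \<le> Lres"
    using Lres by (simp add: restricted_lipschitz_def)
  \<comment> \<open>The delay condition thus has a positive right side. As division by zero gives
    zero, this excludes \<open>Lres = 0\<close>, and then \<open>Lmax\<close> must be
    positive.\<close>
  have "2 \<le> real \<tau> * (real \<tau> + 1)"
    using mult_mono[of 1 "real \<tau>" 2 "real \<tau> + 1"] tau(1) by simp
  then have pos: "0 < sqrt n * Lmax / (4 * exp 1 * Lres)"
    using tau(2) by linarith
  then have "Lres \<noteq> 0"
    by auto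
  with \<open>0 \<le> Lres\<close> have Lres_pos: "0 < Lres"
    by simp
  have "0 < Lmax"
    using pos Lres_pos r_pos by (auto simp: zero_less_divide_iff zero_less_mult_iff mult_less_0_iff)
  have differentiable: "f differentiable (at z)" if "z \<in> \<Omega>" for z
    using smooth(1) neighborhood that by (auto simp: differentiable_on_eq_differentiable_at)
  have J: "closed (J c)" "convex (J c)" for c
    using intervals[of c] by (auto simp: is_interval_convex)
  have conv: "convex_on \<Omega> f"
    using convex_on_subset[OF convex neighborhood(2)] J(2) by (simp add: Omega convex_coord_box)
  have coord: "coord_lipschitz f \<Omega> c Lmax" for c
  proof -
    have "L c \<le> Lmax"
      by (simp add: Lmax(1))
    then have "L c / 2 * t\<^sup>2 \<le> Lmax / 2 * t\<^sup>2" for t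
      by (intro mult_right_mono) auto
    then show ?thesis
      using L[of c] \<open>0 < Lmax\<close> unfolding coord_lipschitz_def by (smt (verit))
  qed
  interpret async_descent J \<Omega> f n Lres Lmax x0 \<tau> k
  proof
    show "4 * exp 1 * Lres * (real \<tau> * (real \<tau> + 1)) \<le> sqrt n * Lmax"
      using tau(2) Lres_pos by (simp add: pos_le_divide_eq mult_ac)
  qed (use n J Omega differentiable conv Lres coord S x0 \<open>0 < Lmax\<close> Lmax(2) tau(1) delay in auto)
  have rho_eq: "\<rho> = async_descent.\<rho> n Lres Lmax \<tau>"
    by (simp add: rho \<rho>_def \<epsilon>_def)
  \<comment> \<open>The induction must be strong because a step also reads the older iterate
    \<open>k m\<close>.\<close>
  have iterate: "x j \<omega> = X (\<lambda>m. I m \<omega>) j" if "\<omega> \<in> space M" for j \<omega>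
  proof (induction j rule: less_induct)
    case (less j)
    show ?case
    proof (cases j)
      case 0
      then show ?thesis
        using iteration that by (simp add: async_coordinate_descent_def)
    next
      case (Suc m)
      have "x m \<omega> = X (\<lambda>m. I m \<omega>) m" "x (k m) \<omega> = X (\<lambda>m. I m \<omega>) (k m)"
        using less Suc k_le[of m] by auto
      then show ?thesis
        using iteration that k_le[of m]
        by (simp add: async_coordinate_descent_def gamma Suc X.simps min_absorb1)
    qed
  qed
  \<comment> \<open>The horizon is taken equal to \<open>j\<close>, the number of choices that
    \<open>x j\<close> depends on; \<open>1 \<le> j\<close> makes it nonzero.\<close>
  have expectation: "(\<integral>\<omega>. (f (x j \<omega>) - opt_value f \<Omega>) \<partial>M) = F j j" if "1 \<le> j" for j
  proof -
    have "(\<integral>\<omega>. (f (x j \<omega>) - opt_value f \<Omega>) \<partial>M)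
        = (\<integral>\<omega>. f (X (\<lambda>m. I m \<omega>) j) - opt_value f \<Omega> \<partial>M)"
      by (intro Bochner_Integration.integral_cong) (auto simp: iterate)
    also have "\<dots> = seq_mean j (\<lambda>i. f (X i j) - opt_value f \<Omega>)"
    proof (rule integral_uniform_choices[OF prob choices])
      show "f (X i j) - opt_value f \<Omega> = f (X i' j) - opt_value f \<Omega>"
        if "\<And>m. m < j \<Longrightarrow> i m = i' m" for i i'
        using X_cong[OF that] by simp
    qed (use that in simp)
    finally show ?thesis
      by (simp add: F_def seq_mean_diff seq_mean_const)
  qed
  show ?thesis
  proof (intro conjI allI impI)
    show "\<gamma> \<le> 1 / \<psi>"
      using steplength_le_inverse_psi by (simp only: gamma psi rho_eq)
    show "\<gamma> \<le> (1 - 1 / \<rho> - 2 / sqrt n) * (sqrt n * Lmax / (4 * Lres * real \<tau> * \<rho> ^ \<tau>))"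
      using steplength_le_second_bound by (simp only: gamma rho_eq)
  next
    fix l :: real and j :: nat
    assume "0 < l" "essentially_strongly_convex f \<Omega> l" "1 \<le> j"
    then show "(\<integral>\<omega>. (f (x j \<omega>) - opt_value f \<Omega>) \<partial>M)
        \<le> (1 - l / (n * (l + 2 * Lmax))) ^ j * (Lmax * R0\<^sup>2 + f x0 - opt_value f \<Omega>)"
      using linear_rate[of l j] by (simp only: expectation R0 S(1))
  next
    fix j :: nat
    assume "1 \<le> j"
    then show "(\<integral>\<omega>. (f (x j \<omega>) - opt_value f \<Omega>) \<partial>M)
        \<le> n * (Lmax * R0\<^sup>2 + f x0 - opt_value f \<Omega>) / (real j + n)"
      using sublinear_rate[of j] by (simp only: expectation R0 S(1))
  qed
qed

end
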